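(* Let $A,C,E\in\mathrm{Mat}_N(\mathbb C)$. If solvable in a non-trivial way, the optimisation problem $$\max_{U}|\operatorname{tr}\{UAU^\dagger C^\dagger\}|\quad\text{subject to}\quad UEU^\dagger=E$$ (with $U$ ranging over the unitary group $U(N)$) entails a constrained $C$-numerical range that is connected. Moreover, it takes the form of a relative $C$-numerical range $$W(C,A)\big|_{\mathrm{Ad}_U(E)=E}:=\{\operatorname{tr}(UAU^\dagger C^\dagger) : UEU^\dagger=E\}=W_{\mathbf K_E}(C,A),$$ and the optimisation problem is solved by the relative $C$-numerical radius $r_{\mathbf K_E}(C,A)$. For Hermitian $E$, $\mathbf K_E$ includes a maximal torus group $\mathbf T\subset SU(N)$.
   Context: $\mathrm{Ad}_U(E)=UEU^\dagger$. The stabiliser group of $E$ is $\mathbf K_E:=\{K\in U(N) : KEK^\dagger=E\}$. For a compact connected subgroup $\mathbf K\subseteq U(N)$, the relative $C$-numerical range of $A$ is $W_{\mathbf K}(C,A):=\{\operatorname{tr}(C^\dagger KAK^\dagger) : K\in\mathbf K\}$, and the relative $C$-numerical radius is $r_{\mathbf K}(C,A):=\max_{K\in\mathbf K}|\operatorname{tr}(C^\dagger KAK^\dagger)|$. The constrained $C$-numerical range of $A$ is the subset of $\{\operatorname{tr}(UAU^\dagger C^\dagger) : U\in U(N)\}$ obtained by admitting only those $U$ that fulfil the constraint. *)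

theory Defs
  imports "HOL-Analysis.Analysis" "HOL-Algebra.Group"
begin

definition cadjoint :: "complex^'n^'m \<Rightarrow> complex^'m^'n" where
  "cadjoint A = (\<chi> i j. cnj (A $ j $ i))"

definition hermitian :: "complex^'n^'n \<Rightarrow> bool" where
  "hermitian A \<longleftrightarrow> cadjoint A = A"

definition unitary_mats :: "(complex^'n^'n) set" where
  "unitary_mats = {U. U ** cadjoint U = mat 1 \<and> cadjoint U ** U = mat 1}"

definition unitary_group :: "(complex^'n^'n) monoid" where
  "unitary_group = \<lparr>carrier = unitary_mats, mult = (**), one = mat 1\<rparr>"

definition special_unitary_group :: "(complex^'n^'n) monoid" where
  "special_unitary_group =
     \<lparr>carrier = {U \<in> unitary_mats. det U = 1}, mult = (**), one = mat 1\<rparr>"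

definition Ad :: "complex^'n^'n \<Rightarrow> complex^'n^'n \<Rightarrow> complex^'n^'n" where
  "Ad U E = U ** E ** cadjoint U"

definition stabiliser :: "complex^'n^'n \<Rightarrow> (complex^'n^'n) set" where
  "stabiliser E = {K \<in> unitary_mats. Ad K E = E}"

definition compact_connected_subgroup ::
    "(complex^'n^'n) set \<Rightarrow> (complex^'n^'n) monoid \<Rightarrow> bool" where
  "compact_connected_subgroup K G \<longleftrightarrow> subgroup K G \<and> compact K \<and> connected K"

text \<open>The relative range and radius are meant for compact connected subgroups
  \<open>K\<close> of the unitary group; the definitions themselves do not enforce this.
  For compact nonempty \<open>K\<close> the maximum in the radius is attained.\<close>

definition relative_numerical_range ::
    "(complex^'n^'n) set \<Rightarrow> complex^'n^'n \<Rightarrow> complex^'n^'n \<Rightarrow> complex set" where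
  "relative_numerical_range \<K> C A =
     {trace (cadjoint C ** K ** A ** cadjoint K) | K. K \<in> \<K>}"

definition relative_numerical_radius ::
    "(complex^'n^'n) set \<Rightarrow> complex^'n^'n \<Rightarrow> complex^'n^'n \<Rightarrow> real" where
  "relative_numerical_radius \<K> C A =
     (GREATEST r. \<exists>K\<in>\<K>. r = cmod (trace (cadjoint C ** K ** A ** cadjoint K)))"

definition constrained_numerical_range ::
    "(complex^'n^'n \<Rightarrow> bool) \<Rightarrow> complex^'n^'n \<Rightarrow> complex^'n^'n \<Rightarrow> complex set" where
  "constrained_numerical_range P C A =
     {trace (U ** A ** cadjoint U ** cadjoint C) | U. U \<in> unitary_mats \<and> P U}"

text \<open>The scalar unitaries satisfy \<open>Ad U E = E\<close> for every \<open>E\<close> and leave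
  \<open>trace (U ** A ** cadjoint U ** cadjoint C)\<close> unchanged, so the constrained problem is
  non-trivial when it admits some other \<open>U\<close>. Note that \<open>range mat\<close> is
  the set of scalar matrices.\<close>

definition nontrivially_solvable :: "complex^'n^'n \<Rightarrow> bool" where
  "nontrivially_solvable E \<longleftrightarrow> (\<exists>U\<in>unitary_mats. Ad U E = E \<and> U \<notin> range mat)"

text \<open>A torus in a matrix Lie group is a compact connected abelian subgroup; being closed,
  it is automatically a Lie subgroup.\<close>

definition torus_in :: "(complex^'n^'n) set \<Rightarrow> (complex^'n^'n) monoid \<Rightarrow> bool" where
  "torus_in T G \<longleftrightarrow> compact_connected_subgroup T G \<and> comm_group (G\<lparr>carrier := T\<rparr>)"

definition maximal_torus_in :: "(complex^'n^'n) set \<Rightarrow> (complex^'n^'n) monoid \<Rightarrow> bool" where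
  "maximal_torus_in T G \<longleftrightarrow>
     torus_in T G \<and> (\<forall>T'. torus_in T' G \<and> T \<subseteq> T' \<longrightarrow> T' = T)"

end

theory Submission imports Defs begin

text \<open>The stabiliser of \<open>E\<close> is the set of unitaries commuting with \<open>E\<close>. Given such a \<open>U\<close>,
  some unit scalar multiple of \<open>U\<close> does not have the eigenvalue \<open>-1\<close>, and a path of rational
  functions of that multiple leads to the identity without leaving the commutant of \<open>E\<close>. Hence
  the stabiliser is compact and connected, and so is its image under a continuous trace map.
  For Hermitian \<open>E\<close> the torus consists of the matrices of determinant 1 that are
  diagonal with unit entries in an orthonormal eigenbasis of \<open>E\<close>; it is maximal because only
  diagonal matrices commute with all of it.\<close>

section \<open>Conjugate transpose and unitary matrices\<close>

lemma cadjoint_cadjoint [simp]: "cadjoint (cadjoint A) = A"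
  by (simp add: cadjoint_def vec_eq_iff)

lemma cadjoint_mult: "cadjoint (A ** B) = cadjoint B ** cadjoint A"
  by (simp add: cadjoint_def matrix_matrix_mult_def vec_eq_iff mult.commute)

lemma cadjoint_mat [simp]: "cadjoint (mat c) = mat (cnj c)"
  by (simp add: cadjoint_def mat_def vec_eq_iff)

lemma cadjoint_add: "cadjoint (A + B) = cadjoint A + cadjoint B"
  by (simp add: cadjoint_def vec_eq_iff)

lemma cadjoint_scaleR: "cadjoint (r *\<^sub>R A) = r *\<^sub>R cadjoint A"
  by (simp add: cadjoint_def vec_eq_iff)

section \<open>Continuity of the matrix operations\<close>

lemma continuous_on_cadjoint [continuous_intros]:
  "continuous_on S f \<Longrightarrow> continuous_on S (\<lambda>x. cadjoint (f x))"
  unfolding cadjoint_def by (intro continuous_intros)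

lemma continuous_on_matrix_mult [continuous_intros]:
  fixes f :: "'a::topological_space \<Rightarrow> complex^'n^'m" and g :: "'a \<Rightarrow> complex^'p^'n"
  shows "continuous_on S f \<Longrightarrow> continuous_on S g \<Longrightarrow> continuous_on S (\<lambda>x. f x ** g x)"
  unfolding matrix_matrix_mult_def by (intro continuous_intros)

lemma continuous_on_trace [continuous_intros]:
  fixes f :: "'a::topological_space \<Rightarrow> complex^'n^'n"
  shows "continuous_on S f \<Longrightarrow> continuous_on S (\<lambda>x. trace (f x))"
  unfolding trace_def by (intro continuous_intros)

lemma continuous_on_mat [continuous_intros]:
  fixes f :: "'a::topological_space \<Rightarrow> complex"
  assumes "continuous_on S f"
  shows "continuous_on S (\<lambda>x. mat (f x) :: complex^'n^'n)"
  unfolding mat_def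
proof (intro continuous_on_vec_lambda)
  fix i j :: 'n
  show "continuous_on S (\<lambda>x. if i = j then f x else 0)"
    using assms by (cases "i = j") auto
qed

section \<open>Scalar matrices and real multiples\<close>

lemma mat_mult_left: "(mat c ** A) $ i $ j = c * A $ i $ j"
  by (simp add: matrix_matrix_mult_def mat_def if_distrib [of "\<lambda>x. x * _"] cong: if_cong)

lemma mat_mult_right: "(A ** mat c) $ i $ j = A $ i $ j * c"
  by (simp add: matrix_matrix_mult_def mat_def if_distrib [of "\<lambda>x. _ * x"] cong: if_cong)

lemma scaleR_matrix_vector: "(r *\<^sub>R A) *v x = r *\<^sub>R (A *v (x :: complex^'n))"
  by (simp add: matrix_vector_mult_def vec_eq_iff scaleR_sum_right)

lemma scaleR_eq_scale: "r *\<^sub>R x = complex_of_real r *s x"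
  by (simp add: vec_eq_iff scaleR_conv_of_real [where 'a = complex])

lemma mat_vector_mult: "mat c *v x = c *s x"
  by (simp add: vec_eq_iff matrix_vector_mult_def mat_def
      if_distrib [of "\<lambda>x. x * _"] cong: if_cong)

lemma matrix_add_rdistrib: "(A + B) ** C = A ** C + B ** (C :: complex^'n^'m)"
  by (simp add: matrix_matrix_mult_def vec_eq_iff sum.distrib distrib_right)

lemma mat_commute: "mat (c::complex) ** A = A ** mat c"
  by (simp add: vec_eq_iff mat_mult_left mat_mult_right mult.commute)

lemma mat_mult_mat: "mat (c::complex) ** mat d = mat (c * d)"
  by (simp add: vec_eq_iff mat_mult_left) (simp add: mat_def)

section \<open>Unitary matrices: algebra, compactness, group structure\<close>

lemma unitary_iff: "U \<in> unitary_mats \<longleftrightarrow> U ** cadjoint U = mat 1"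
  unfolding unitary_mats_def using matrix_left_right_inverse by blast

lemma unitary_iff': "U \<in> unitary_mats \<longleftrightarrow> cadjoint U ** U = mat 1"
  unfolding unitary_mats_def using matrix_left_right_inverse by blast

lemma unitaryD:
  assumes "U \<in> unitary_mats"
  shows "U ** cadjoint U = mat 1" "cadjoint U ** U = mat 1"
    "U ** (cadjoint U ** A) = A" "cadjoint U ** (U ** A) = A"
  using assms by (simp_all add: unitary_mats_def matrix_mul_assoc)

lemma unitary_mult: "U \<in> unitary_mats \<Longrightarrow> V \<in> unitary_mats \<Longrightarrow> U ** V \<in> unitary_mats"
  by (simp add: unitary_iff cadjoint_mult unitaryD flip: matrix_mul_assoc)

lemma unitary_cadjoint: "U \<in> unitary_mats \<Longrightarrow> cadjoint U \<in> unitary_mats"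
  by (simp add: unitary_mats_def)

lemma unit_mult_cnj: "cmod c = 1 \<Longrightarrow> c * cnj c = 1"
  by (simp flip: complex_norm_square)

lemma unitary_mat: "cmod c = 1 \<Longrightarrow> mat c \<in> unitary_mats"
  by (simp add: unitary_iff mat_mult_mat unit_mult_cnj)

lemma mat_1_unitary [simp]: "mat 1 \<in> unitary_mats"
  by (simp add: unitary_mat)

text \<open>The diagonal entries of \<open>U ** cadjoint U\<close> are the squared norms of the rows
  of \<open>U\<close>, so every row is a unit vector.\<close>

lemma unitary_entry_le_1:
  assumes "U \<in> unitary_mats"
  shows "cmod (U $ i $ j) \<le> 1"
proof -
  have "(\<Sum>k\<in>UNIV. complex_of_real ((cmod (U $ i $ k))\<^sup>2)) = (U ** cadjoint U) $ i $ i"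
    by (simp only: matrix_matrix_mult_def cadjoint_def vec_lambda_beta complex_norm_square)
  also have "\<dots> = 1"
    using assms by (simp add: unitaryD mat_def)
  finally have "(\<Sum>k\<in>UNIV. (cmod (U $ i $ k))\<^sup>2) = 1"
    using of_real_eq_1_iff of_real_sum by (metis (no_types, lifting) sum.cong)
  moreover have "(cmod (U $ i $ j))\<^sup>2 \<le> (\<Sum>k\<in>UNIV. (cmod (U $ i $ k))\<^sup>2)"
    by (rule member_le_sum) auto
  ultimately show ?thesis
    by (simp add: power_le_one_iff)
qed

text \<open>Heine-Borel: the entries are bounded by 1, and the defining equations are continuous in
  \<open>U\<close>.\<close>

lemma compact_unitary_mats: "compact (unitary_mats :: (complex^'n^'n) set)"
  unfolding compact_eq_bounded_closed
proof
  show "bounded (unitary_mats :: (complex^'n^'n) set)"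
    unfolding bounded_iff
  proof (intro exI ballI)
    fix U :: "complex^'n^'n" assume U: "U \<in> unitary_mats"
    have "norm U \<le> (\<Sum>i\<in>UNIV. norm (U $ i))"
      by (simp add: norm_vec_def L2_set_le_sum)
    also have "\<dots> \<le> (\<Sum>i\<in>UNIV. \<Sum>j\<in>UNIV. cmod (U $ i $ j))"
      by (intro sum_mono) (simp add: norm_vec_def L2_set_le_sum)
    also have "\<dots> \<le> (\<Sum>i\<in>(UNIV::'n set). \<Sum>j\<in>(UNIV::'n set). 1)"
      by (intro sum_mono unitary_entry_le_1 U)
    finally show "norm U \<le> (\<Sum>i\<in>(UNIV::'n set). \<Sum>j\<in>(UNIV::'n set). 1)" .
  qed
  show "closed (unitary_mats :: (complex^'n^'n) set)"
    unfolding unitary_mats_def by (intro closed_Collect_conj closed_Collect_eq continuous_intros)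
qed

lemma group_unitary_group: "group unitary_group"
proof (rule groupI)
  fix U assume "U \<in> carrier unitary_group"
  then show "\<exists>V\<in>carrier unitary_group. V \<otimes>\<^bsub>unitary_group\<^esub> U = \<one>\<^bsub>unitary_group\<^esub>"
    by (auto simp: unitary_group_def intro: unitary_cadjoint unitaryD)
qed (auto simp: unitary_group_def unitary_mult matrix_mul_assoc)

lemma inv_unitary_group:
  assumes "U \<in> unitary_mats"
  shows "inv\<^bsub>unitary_group\<^esub> U = cadjoint U"
  using assms
  by (intro group.inv_equality [OF group_unitary_group])
    (auto simp: unitary_group_def unitaryD unitary_cadjoint)

section \<open>The stabiliser\<close>

text \<open>Multiplying by \<open>K\<close> on the right turns \<open>Ad K E = E\<close> into
  commutation. That form is linear in \<open>K\<close>, which suits products, limits and rational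
  functions of \<open>K\<close>.\<close>

lemma stabiliser_iff: "K \<in> stabiliser E \<longleftrightarrow> K \<in> unitary_mats \<and> K ** E = E ** K"
proof -
  have "K ** E ** cadjoint K = E \<longleftrightarrow> K ** E = E ** K" if K: "K \<in> unitary_mats"
  proof
    assume *: "K ** E ** cadjoint K = E"
    have "K ** E = K ** E ** cadjoint K ** K"
      using K by (simp add: unitaryD flip: matrix_mul_assoc)
    then show "K ** E = E ** K"
      by (simp add: *)
  next
    assume "K ** E = E ** K"
    then show "K ** E ** cadjoint K = E"
      using K by (simp add: unitaryD flip: matrix_mul_assoc)
  qed
  then show ?thesis
    by (auto simp: stabiliser_def Ad_def)
qed

lemma compact_stabiliser: "compact (stabiliser E)"
proof -
  have "stabiliser E = unitary_mats \<inter> {K. K ** E = E ** K}"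
    by (auto simp: stabiliser_iff)
  moreover have "closed {K. K ** E = E ** K}"
    by (intro closed_Collect_eq continuous_intros)
  ultimately show ?thesis
    using compact_Int_closed [OF compact_unitary_mats] by metis
qed

lemma stabiliser_mult:
  assumes "U \<in> stabiliser E" "V \<in> stabiliser E"
  shows "U ** V \<in> stabiliser E"
  using assms by (simp add: stabiliser_iff unitary_mult flip: matrix_mul_assoc)
    (simp add: matrix_mul_assoc)

text \<open>Multiply \<open>U ** E = E ** U\<close> by \<open>cadjoint U\<close> from both
  sides.\<close>

lemma stabiliser_cadjoint:
  assumes "U \<in> stabiliser E"
  shows "cadjoint U \<in> stabiliser E"
proof -
  have U: "U \<in> unitary_mats" "U ** E = E ** U"
    using assms by (auto simp: stabiliser_iff)
  have "cadjoint U ** E = cadjoint U ** (E ** U) ** cadjoint U"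
    using U(1) by (simp add: unitaryD flip: matrix_mul_assoc)
  also have "\<dots> = E ** cadjoint U"
    using U(1) by (simp add: unitaryD matrix_mul_assoc flip: U(2))
  finally show ?thesis
    using U by (simp add: stabiliser_iff unitary_cadjoint)
qed

lemma mat_in_stabiliser: "cmod c = 1 \<Longrightarrow> mat c \<in> stabiliser E"
  by (simp add: stabiliser_iff unitary_mat mat_commute)

lemma subgroup_stabiliser: "subgroup (stabiliser E) unitary_group"
proof (rule group.subgroupI [OF group_unitary_group])
  show "stabiliser E \<subseteq> carrier unitary_group"
    by (auto simp: stabiliser_iff unitary_group_def)
  show "stabiliser E \<noteq> {}"
    using mat_in_stabiliser [of 1] by auto
  show "inv\<^bsub>unitary_group\<^esub> U \<in> stabiliser E" if "U \<in> stabiliser E" for U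
    using that by (metis inv_unitary_group stabiliser_cadjoint stabiliser_iff)
  show "U \<otimes>\<^bsub>unitary_group\<^esub> V \<in> stabiliser E"
    if "U \<in> stabiliser E" "V \<in> stabiliser E" for U V
    using stabiliser_mult [OF that] by (simp add: unitary_group_def)
qed

section \<open>The Hermitian form\<close>

text \<open>Linear in the first argument and conjugate-linear in the second. Its real part is the
  inner product of the underlying real Euclidean space, so results on real orthogonality and
  dimension apply.\<close>

definition cinner :: "complex^'n \<Rightarrow> complex^'n \<Rightarrow> complex" where
  "cinner x y = (\<Sum>i\<in>UNIV. x $ i * cnj (y $ i))"

lemma Re_cinner: "Re (cinner x y) = x \<bullet> y"
  by (simp add: cinner_def inner_vec_def inner_complex_def)

lemma cinner_add_left: "cinner (x + y) z = cinner x z + cinner y z"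
  by (simp add: cinner_def distrib_right sum.distrib)

lemma cinner_scaleR_left: "cinner (r *\<^sub>R x) z = r *\<^sub>R cinner x z"
  by (simp add: cinner_def scaleR_sum_right)

lemma cinner_scale_left: "cinner (c *s x) y = c * cinner x y"
  by (simp add: cinner_def sum_distrib_left mult.assoc)

lemma cinner_scale_right: "cinner x (c *s y) = cnj c * cinner x y"
  by (simp add: cinner_def sum_distrib_left mult_ac)

lemma cinner_self: "cinner x x = of_real ((norm x)\<^sup>2)"
proof -
  have "Im (cinner x x) = 0"
    by (simp add: cinner_def mult.commute)
  then show ?thesis
    by (simp add: complex_eq_iff Re_cinner power2_norm_eq_inner)
qed

lemma cinner_commute: "cinner y x = cnj (cinner x y)"
  by (simp add: cinner_def mult.commute)

lemma cinner_adjoint: "cinner (A *v x) y = cinner x (cadjoint A *v y)"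
proof -
  have "cinner (A *v x) y = (\<Sum>i\<in>UNIV. \<Sum>j\<in>UNIV. A $ i $ j * x $ j * cnj (y $ i))"
    by (simp add: cinner_def matrix_vector_mult_def sum_distrib_right)
  also have "\<dots> = (\<Sum>j\<in>UNIV. \<Sum>i\<in>UNIV. A $ i $ j * x $ j * cnj (y $ i))"
    by (rule sum.swap)
  also have "\<dots> = cinner x (cadjoint A *v y)"
    by (simp add: cinner_def matrix_vector_mult_def cadjoint_def sum_distrib_left mult_ac)
  finally show ?thesis .
qed

lemma cinner_unitary:
  assumes "U \<in> unitary_mats"
  shows "cinner (U *v x) (U *v y) = cinner x y"
  using assms by (simp add: cinner_adjoint matrix_vector_mul_assoc unitaryD)

lemma norm_unitary:
  assumes "U \<in> unitary_mats"
  shows "norm (U *v x) = norm x"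
  using cinner_unitary [OF assms, of x x] unfolding cinner_self of_real_eq_iff by simp

text \<open>Eigenvectors for distinct eigenvalues on the unit circle are orthogonal, hence linearly
  independent over the reals, and the space is finite-dimensional.\<close>

lemma finite_unit_eigenvalues_unitary:
  assumes U: "U \<in> unitary_mats"
  shows "finite {l. cmod l = 1 \<and> (\<exists>v. v \<noteq> 0 \<and> U *v v = l *s v)}" (is "finite ?L")
proof -
  have "\<forall>l\<in>?L. \<exists>v. v \<noteq> 0 \<and> U *v v = l *s v"
    by blast
  from bchoice [OF this] obtain v
    where v: "\<And>l. l \<in> ?L \<Longrightarrow> v l \<noteq> 0 \<and> U *v v l = l *s v l"
    by blast
  have orth: "v k \<bullet> v l = 0" if "k \<in> ?L" "l \<in> ?L" "k \<noteq> l" for k l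
  proof -
    have "k * cnj l * cinner (v k) (v l) = cinner (U *v v k) (U *v v l)"
      using v [OF that(1)] v [OF that(2)] by (simp only: cinner_scale_left cinner_scale_right mult_ac)
    also have "\<dots> = cinner (v k) (v l)"
      by (rule cinner_unitary [OF U])
    finally have "k * cnj l * cinner (v k) (v l) = cinner (v k) (v l)" .
    \<comment> \<open>On the unit circle \<open>cnj l\<close> is the inverse of \<open>l\<close>, so
      a product of 1 would force \<open>k = l\<close>.\<close>
    moreover have "k * cnj l \<noteq> 1"
    proof
      assume "k * cnj l = 1"
      then have "k * (cnj l * l) = l"
        by (metis mult.assoc mult_1)
      moreover have "cnj l * l = 1"
        using that(2) by (simp add: mult.commute unit_mult_cnj)
      ultimately show False
        using that(3) by simp
    qed
    ultimately have "cinner (v k) (v l) = 0"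
      by simp
    then show ?thesis
      by (metis Re_cinner zero_complex.sel(1))
  qed
  \<comment> \<open>Injectivity carries finiteness of the set of eigenvectors back to the set of
    eigenvalues.\<close>
  have "inj_on v ?L"
  proof (rule inj_onI, rule ccontr)
    fix k l assume kl: "k \<in> ?L" "l \<in> ?L" "v k = v l" "k \<noteq> l"
    then have "v k \<bullet> v k = 0"
      using orth [OF kl(1,2,4)] by simp
    then show False
      using v [OF kl(1)] by simp
  qed
  moreover have "independent (v ` ?L)"
  proof (rule pairwise_orthogonal_independent)
    show "pairwise orthogonal (v ` ?L)"
      unfolding pairwise_def orthogonal_def using orth by blast
    show "0 \<notin> v ` ?L"
      using v by (metis (no_types, lifting) imageE)
  qed
  ultimately show ?thesis
    using finite_imageD finiteI_independent by blast
qed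

text \<open>A finite connected set has at most one point, but the circle is connected and contains
  both 1 and -1.\<close>

lemma infinite_unit_circle: "infinite (sphere (0::complex) 1)"
proof -
  have "\<not> sphere (0::complex) 1 \<subseteq> {a}" for a
  proof
    assume "sphere 0 1 \<subseteq> {a}"
    moreover have "1 \<in> sphere (0::complex) 1" "-1 \<in> sphere (0::complex) 1"
      by auto
    ultimately have "(1::complex) = -1"
      by blast
    then show False
      by simp
  qed
  moreover have "connected (sphere (0::complex) 1)"
    by (rule connected_sphere) simp
  ultimately show ?thesis
    by (metis connected_finite_iff_sing empty_subsetI order_refl)
qed

section \<open>Connectedness of the stabiliser\<close>

text \<open>The circle of unit scalars is connected and multiplies the stabiliser into
  itself.\<close>

lemma connected_component_unit_scalar:
  assumes "U \<in> stabiliser E" "cmod c = 1"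
  shows "connected_component (stabiliser E) U (mat c ** U)"
  unfolding connected_component_def
proof (intro exI conjI)
  let ?T = "(\<lambda>c. mat c ** U) ` sphere 0 1"
  show "connected ?T"
    by (intro connected_continuous_image continuous_intros connected_sphere) simp
  show "?T \<subseteq> stabiliser E"
    using assms(1) by (auto intro!: stabiliser_mult mat_in_stabiliser)
  have "mat 1 ** U \<in> ?T"
    by (intro imageI) simp
  then show "U \<in> ?T"
    by simp
  show "mat c ** U \<in> ?T"
    using assms by simp
qed

text \<open>The path is \<open>s \<mapsto> (U + s)(1 + s U)\<^sup>-\<^sup>1\<close>: on eigenvalues these are Moebius
  transformations of the unit circle that contract everything except \<open>-1\<close> towards \<open>1\<close>.\<close>

lemma connected_component_mat_1:
  fixes U :: "complex^'n^'n"
  assumes U: "U \<in> stabiliser E" and no_ev: "\<And>v. U *v v = - v \<Longrightarrow> v = 0"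
  shows "connected_component (stabiliser E) U (mat 1)"
proof -
  define P where "P s = U + s *\<^sub>R mat 1" for s
  define Q where "Q s = mat 1 + s *\<^sub>R U" for s
  have unitary: "U \<in> unitary_mats" and comm: "U ** E = E ** U"
    using U by (auto simp: stabiliser_iff)
  \<comment> \<open>Invertibility of \<open>Q s\<close>: since \<open>U\<close> preserves norms, a
    nonzero kernel vector forces \<open>s = 1\<close>, and then \<open>U *v v = - v\<close>, which
    \<open>no_ev\<close> excludes.\<close>
  have "Q s *v v = 0 \<Longrightarrow> v = 0" if "s \<in> {0..1}" for s v
  proof -
    assume "Q s *v v = 0"
    then have eq: "s *\<^sub>R (U *v v) = - v"
      by (simp add: Q_def matrix_vector_mult_add_rdistrib scaleR_matrix_vector eq_neg_iff_add_eq_0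
          add.commute)
    then have "norm (s *\<^sub>R (U *v v)) = norm v"
      by simp
    then have "s * norm v = norm v"
      using that by (simp add: norm_unitary [OF unitary])
    then have "s = 1 \<or> v = 0"
      by auto
    then show "v = 0"
      using eq no_ev by auto
  qed
  then have "\<forall>s\<in>{0..1}. \<exists>R. R ** Q s = mat 1"
    by (simp add: matrix_left_invertible_ker)
  then obtain R where RQ: "\<And>s. s \<in> {0..1} \<Longrightarrow> R s ** Q s = mat 1"
    by metis
  then have QR: "\<And>s. s \<in> {0..1} \<Longrightarrow> Q s ** R s = mat 1"
    using matrix_left_right_inverse by blast
  define V where "V s = P s ** R s" for s
  \<comment> \<open>An equation for \<open>V s\<close> free of the inverse \<open>R s\<close>. It is
    polynomial in \<open>s\<close> and \<open>W\<close>, and it serves both for the closed graph and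
    for the two endpoints.\<close>
  have V_eq: "V s = W \<longleftrightarrow> W ** Q s = P s" if "s \<in> {0..1}" for s W
  proof
    assume "V s = W"
    then show "W ** Q s = P s"
      using RQ [OF that] by (auto simp: V_def simp flip: matrix_mul_assoc)
  next
    assume "W ** Q s = P s"
    then show "V s = W"
      using QR [OF that] by (metis V_def matrix_mul_assoc matrix_mul_rid)
  qed
  have V_stab: "V s \<in> stabiliser E" if s: "s \<in> {0..1}" for s
  proof -
    have PQ: "P s ** Q s = Q s ** P s"
      by (simp add: P_def Q_def matrix_add_ldistrib matrix_add_rdistrib
          matrix_scalar_ac scalar_matrix_assoc [symmetric] scaleR_add_right add_ac)
    have RP: "R s ** P s = P s ** R s"
    proof -
      have "R s ** P s = R s ** (P s ** Q s) ** R s"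
        using QR [OF s] by (simp flip: matrix_mul_assoc)
      also have "\<dots> = (R s ** Q s) ** P s ** R s"
        by (simp only: matrix_mul_assoc PQ)
      finally show ?thesis
        using RQ [OF s] by simp
    qed
    \<comment> \<open>Both sides expand to \<open>1 + s^2\<close> times the identity plus
      \<open>s\<close> times \<open>U + cadjoint U\<close>.\<close>
    have PP: "P s ** cadjoint (P s) = Q s ** cadjoint (Q s)"
      using unitaryD(1) [OF unitary]
      by (simp add: P_def Q_def matrix_add_ldistrib matrix_add_rdistrib cadjoint_add cadjoint_scaleR
          matrix_scalar_ac scalar_matrix_assoc [symmetric] scaleR_add_right add_ac)
    have QR': "cadjoint (Q s) ** cadjoint (R s) = mat 1"
      using RQ [OF s] by (metis cadjoint_mult cadjoint_mat complex_cnj_one)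
    have "V s = R s ** P s"
      by (simp add: V_def RP)
    then have "V s ** cadjoint (V s) = R s ** (P s ** cadjoint (P s)) ** cadjoint (R s)"
      by (simp add: cadjoint_mult matrix_mul_assoc)
    also have "\<dots> = (R s ** Q s) ** (cadjoint (Q s) ** cadjoint (R s))"
      by (simp add: PP matrix_mul_assoc)
    also have "\<dots> = mat 1"
      by (simp add: RQ [OF s] QR')
    finally have "V s \<in> unitary_mats"
      by (simp add: unitary_iff)
    moreover have "V s ** E = E ** V s"
    proof -
      have PE: "P s ** E = E ** P s" and QE: "Q s ** E = E ** Q s"
        using comm by (simp_all add: P_def Q_def matrix_add_ldistrib matrix_add_rdistrib
            matrix_scalar_ac scalar_matrix_assoc [symmetric] scaleR_add_right add_ac)
      have "R s ** E = R s ** (E ** Q s) ** R s"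
        using QR [OF s] by (simp flip: matrix_mul_assoc)
      also have "\<dots> = (R s ** Q s) ** E ** R s"
        by (simp only: matrix_mul_assoc flip: QE)
      finally have "R s ** E = E ** R s"
        using RQ [OF s] by simp
      then show ?thesis
        unfolding V_def by (metis PE matrix_mul_assoc)
    qed
    ultimately show ?thesis
      by (simp add: stabiliser_iff)
  qed
  have "continuous_on {0..1} V"
  \<comment> \<open>A map into a compact set with closed graph is continuous; this replaces an
    argument about continuity of matrix inversion.\<close>
  proof (rule continuous_from_closed_graph [OF compact_stabiliser])
    show "V \<in> {0..1} \<rightarrow> stabiliser E"
      using V_stab by blast
    have "(\<lambda>s. (s, V s)) ` {0..1} = {0..1} \<times> UNIV \<inter> {z. snd z ** Q (fst z) = P (fst z)}"
      using V_eq by force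
    moreover have "closed {z. snd z ** Q (fst z) = P (fst z)}"
      unfolding P_def Q_def by (intro closed_Collect_eq continuous_intros)
    ultimately show "closed ((\<lambda>s. (s, V s)) ` {0..1})"
      by (simp add: closed_Int closed_Times)
  qed
  then have "connected (V ` {0..1})"
    by (intro connected_continuous_image) auto
  moreover have "V 0 = U" "V 1 = mat 1"
    by (simp_all add: V_eq P_def Q_def add.commute)
  then have "U \<in> V ` {0..1}" "mat 1 \<in> V ` {0..1}"
    by (metis atLeastAtMost_iff imageI order_refl zero_le_one)+
  ultimately show ?thesis
    unfolding connected_component_def using V_stab by blast
qed

lemma connected_stabiliser: "connected (stabiliser E)"
proof -
  have "connected_component (stabiliser E) (mat 1) U" if U: "U \<in> stabiliser E" for U
  proof -
    \<comment> \<open>The infinite unit circle contains a point outside the finite set of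
      eigenvalues.\<close>
    obtain c where c: "cmod c = 1" and ev: "\<And>v. U *v v = c *s v \<Longrightarrow> v = 0"
    proof -
      have "\<not> sphere 0 1 \<subseteq> {l. cmod l = 1 \<and> (\<exists>v. v \<noteq> 0 \<and> U *v v = l *s v)}"
        using finite_unit_eigenvalues_unitary [of U] infinite_unit_circle U finite_subset
        by (metis (no_types, lifting) stabiliser_iff)
      then show ?thesis
        using that by (fastforce simp: subset_iff)
    qed
    \<comment> \<open>Multiplication by \<open>- cnj c\<close> moves the non-eigenvalue
      \<open>c\<close> to -1, as the path to the identity requires.\<close>
    let ?W = "mat (- cnj c) ** U"
    have W: "?W \<in> stabiliser E"
      using c U by (simp add: stabiliser_mult mat_in_stabiliser)
    have "v = 0" if "?W *v v = - v" for v
    proof (rule ev)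
      have "U *v v = mat (c * cnj c) *v (U *v v)"
        using c by (simp add: unit_mult_cnj)
      also have "\<dots> = mat (- c) *v (?W *v v)"
        by (simp add: matrix_vector_mul_assoc matrix_mul_assoc mat_mult_mat)
      also have "\<dots> = c *s v"
        unfolding that by (simp add: mat_vector_mult vec_eq_iff)
      finally show "U *v v = c *s v" .
    qed
    then have "connected_component (stabiliser E) ?W (mat 1)"
      by (intro connected_component_mat_1 W)
    moreover have "connected_component (stabiliser E) U ?W"
      using c U by (intro connected_component_unit_scalar) auto
    ultimately show ?thesis
      by (meson connected_component_sym connected_component_trans)
  qed
  then show ?thesis
    unfolding connected_iff_connected_component
    by (meson connected_component_sym connected_component_trans)
qed

section \<open>Spectral theorem for Hermitian matrices\<close>

text \<open>A dimension count over the reals: complex orthogonality to \<open>f i\<close> is real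
  orthogonality to both \<open>f i\<close> and \<open>\<i> *s f i\<close>, and these at most
  \<open>2 * card I\<close> vectors cannot span a space of real dimension
  \<open>2 * CARD('n)\<close>.\<close>

lemma exists_orthogonal_unit_vector:
  fixes f :: "'n \<Rightarrow> complex^'n"
  assumes "I \<noteq> UNIV"
  obtains v where "norm v = 1" "\<And>i. i \<in> I \<Longrightarrow> cinner v (f i) = 0"
proof -
  let ?S = "f ` I \<union> (\<lambda>i. \<i> *s f i) ` I"
  have "card I < CARD('n)"
    using assms by (intro psubset_card_mono) auto
  moreover have "card ?S \<le> card I + card I"
    by (intro card_Un_le [THEN order_trans] add_mono card_image_le) auto
  moreover have "dim ?S \<le> card ?S"
    by (intro dim_le_card') auto
  ultimately have "dim ?S < DIM(complex^'n)"
    by simp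
  then obtain x where x: "x \<noteq> 0" "\<And>y. y \<in> span ?S \<Longrightarrow> orthogonal x y"
    using orthogonal_to_subspace_exists by blast
  show ?thesis
  proof (rule that)
    show "norm (sgn x) = 1"
      using x by (simp add: norm_sgn)
    fix i assume i: "i \<in> I"
    have "x \<bullet> f i = 0" "x \<bullet> (\<i> *s f i) = 0"
      using x(2) i by (auto simp: orthogonal_def intro: span_base)
    then have "cinner x (f i) = 0"
      by (simp add: complex_eq_iff cinner_scale_right flip: Re_cinner)
    then show "cinner (sgn x) (f i) = 0"
      by (simp add: sgn_div_norm cinner_scaleR_left)
  qed
qed

lemma inner_hermitian:
  assumes "hermitian E"
  shows "(E *v x) \<bullet> y = x \<bullet> (E *v y)"
  using assms by (simp add: hermitian_def cinner_adjoint flip: Re_cinner)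

text \<open>An eigenvector is found where the Rayleigh quotient is maximal on the orthogonal
  complement of the given eigenvectors.\<close>

lemma exists_orthogonal_eigenvector:
  fixes f :: "'n \<Rightarrow> complex^'n"
  assumes E: "hermitian E" and "I \<noteq> UNIV" and f: "\<And>i. i \<in> I \<Longrightarrow> \<exists>l. E *v f i = l *s f i"
  obtains v l where "norm v = 1" "\<And>i. i \<in> I \<Longrightarrow> cinner v (f i) = 0" "E *v v = l *s v"
proof -
  define W where "W = {w. \<forall>i\<in>I. cinner w (f i) = 0}"
  have W_add: "x + y \<in> W" if "x \<in> W" "y \<in> W" for x y
    using that by (simp add: W_def cinner_add_left)
  have W_scaleR: "r *\<^sub>R x \<in> W" if "x \<in> W" for r x
    using that by (simp add: W_def cinner_scaleR_left)
  \<comment> \<open>Moving the Hermitian \<open>E\<close> to the other argument makes it act on the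
    eigenvector \<open>f i\<close>, which only contributes a scalar factor.\<close>
  have W_E: "E *v x \<in> W" if x: "x \<in> W" for x
  proof -
    have "cinner (E *v x) (f i) = 0" if i: "i \<in> I" for i
    proof -
      obtain l where "E *v f i = l *s f i"
        using f i by blast
      then show ?thesis
        using E x i by (simp add: W_def hermitian_def cinner_adjoint cinner_scale_right)
    qed
    then show ?thesis
      by (simp add: W_def)
  qed
  have "compact (sphere 0 1 \<inter> W)"
  proof (intro compact_Int_closed compact_sphere)
    have "W = (\<Inter>i\<in>I. {w. cinner w (f i) = 0})"
      by (auto simp: W_def)
    moreover have "closed {w. cinner w (f i) = 0}" for i
      unfolding cinner_def by (intro closed_Collect_eq continuous_intros)
    ultimately show "closed W"
      by (simp add: closed_INT)
  qed
  moreover have "sphere 0 1 \<inter> W \<noteq> {}"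
  proof -
    obtain v where "norm v = 1" "\<And>i. i \<in> I \<Longrightarrow> cinner v (f i) = 0"
      using exists_orthogonal_unit_vector [OF \<open>I \<noteq> UNIV\<close>, of f] by blast
    then have "v \<in> sphere 0 1 \<inter> W"
      by (simp add: W_def)
    then show ?thesis
      by blast
  qed
  moreover have "continuous_on (sphere 0 1 \<inter> W) (\<lambda>x. x \<bullet> (E *v x))"
    unfolding matrix_vector_mult_def by (intro continuous_intros)
  ultimately obtain v where v: "v \<in> sphere 0 1 \<inter> W"
    and max: "\<And>w. w \<in> sphere 0 1 \<inter> W \<Longrightarrow> w \<bullet> (E *v w) \<le> v \<bullet> (E *v v)"
    using continuous_attains_sup [of "sphere 0 1 \<inter> W" "\<lambda>x. x \<bullet> (E *v x)"] by blast
  define l where "l = v \<bullet> (E *v v)"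
  have E_scaleR: "E *v (r *\<^sub>R x) = r *\<^sub>R (E *v x)" for r x
    by (simp add: matrix_vector_mult_def vec_eq_iff scaleR_sum_right)
  \<comment> \<open>Both sides are homogeneous of degree 2, so the bound on the unit sphere extends
    to all of \<open>W\<close>.\<close>
  have quad: "w \<bullet> (E *v w) \<le> l * (w \<bullet> w)" if w: "w \<in> W" for w
  proof (cases "w = 0")
    case False
    have "sgn w \<in> sphere 0 1 \<inter> W"
      using False W_scaleR [OF w] by (simp add: norm_sgn sgn_div_norm)
    then have "sgn w \<bullet> (E *v sgn w) \<le> l"
      unfolding l_def by (rule max)
    then have "w \<bullet> (E *v w) / (norm w)\<^sup>2 \<le> l"
      by (simp add: sgn_div_norm E_scaleR power2_eq_square divide_simps)
    then show ?thesis
      using False by (simp add: pos_divide_le_eq power2_norm_eq_inner)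
  qed simp
  \<comment> \<open>The residual of the eigenvalue equation. It lies in \<open>W\<close>, so it is
    an admissible direction in which to perturb the maximiser \<open>v\<close>.\<close>
  define z where "z = E *v v - l *\<^sub>R v"
  have z: "z \<in> W"
    using W_add [OF W_E W_scaleR, of v v "- l"] v by (simp add: z_def)
  define c where "c = l * (z \<bullet> z) - z \<bullet> (E *v z)"
  have vv: "v \<bullet> v = 1"
    using v by (simp flip: power2_norm_eq_inner)
  \<comment> \<open>Apply \<open>quad\<close> to \<open>v + t *\<^sub>R z\<close>: the constant
    terms cancel, the linear term is \<open>2 * t * (z \<bullet> z)\<close>, and \<open>c\<close>
    collects the quadratic terms.\<close>
  have ineq: "2 * t * (z \<bullet> z) \<le> t\<^sup>2 * c" for t :: real
  proof -
    have "v + t *\<^sub>R z \<in> W"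
      using v z by (simp add: W_add W_scaleR)
    moreover have "v \<bullet> (E *v z) = z \<bullet> (E *v v)"
      using inner_hermitian [OF E, of v z] by (simp only: inner_commute)
    then have "(v + t *\<^sub>R z) \<bullet> (E *v (v + t *\<^sub>R z)) =
        l + 2 * t * (z \<bullet> (E *v v)) + t\<^sup>2 * (z \<bullet> (E *v z))"
      by (simp add: matrix_vector_right_distrib E_scaleR inner_add_left inner_add_right
          power2_eq_square l_def distrib_left mult.assoc)
    moreover have "(v + t *\<^sub>R z) \<bullet> (v + t *\<^sub>R z) = 1 + 2 * t * (z \<bullet> v) + t\<^sup>2 * (z \<bullet> z)"
      by (simp add: inner_add_left inner_add_right vv inner_commute power2_eq_square distrib_left mult.assoc)
    ultimately have "l + 2 * t * (z \<bullet> (E *v v)) + t\<^sup>2 * (z \<bullet> (E *v z))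
        \<le> l * (1 + 2 * t * (z \<bullet> v) + t\<^sup>2 * (z \<bullet> z))"
      using quad by metis
    moreover have "z \<bullet> z = z \<bullet> (E *v v) - l * (z \<bullet> v)"
      by (metis inner_diff_right inner_scaleR_right z_def)
    then have "2 * t * (z \<bullet> z) = 2 * t * (z \<bullet> (E *v v)) - l * (2 * t * (z \<bullet> v))"
      by (simp only: right_diff_distrib mult_ac)
    moreover have "t\<^sup>2 * c = l * (t\<^sup>2 * (z \<bullet> z)) - t\<^sup>2 * (z \<bullet> (E *v z))"
      by (simp only: c_def right_diff_distrib mult_ac)
    ultimately show ?thesis
      by (simp only: distrib_left mult_1_right)
  qed
  have "z \<bullet> z = 0"
  proof (rule ccontr)
    assume "z \<bullet> z \<noteq> 0"
    then have pos: "z \<bullet> z > 0"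
      by (simp add: order_less_le)
    \<comment> \<open>Small enough that \<open>t * c\<close> is at most
      \<open>z \<bullet> z\<close>, so the linear term of \<open>ineq\<close> outweighs the
      quadratic one.\<close>
    define t where "t = (z \<bullet> z) / (\<bar>c\<bar> + 1)"
    have t: "t > 0"
      using pos by (simp add: t_def)
    have "t * c \<le> t * (\<bar>c\<bar> + 1)"
      using t by (intro mult_left_mono) auto
    also have "\<dots> = z \<bullet> z"
      by (simp add: t_def)
    finally have "t * (t * c) < t * (2 * (z \<bullet> z))"
      using t pos by (intro mult_strict_left_mono) linarith+
    then show False
      using ineq [of t] by (simp add: power2_eq_square mult_ac)
  qed
  then have "E *v v = complex_of_real l *s v"
    by (simp add: z_def scaleR_eq_scale)
  moreover have "norm v = 1" "\<And>i. i \<in> I \<Longrightarrow> cinner v (f i) = 0"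
    using v by (auto simp: W_def)
  ultimately show ?thesis
    using that by blast
qed

definition diag :: "'a::zero^'n \<Rightarrow> 'a^'n^'n" where
  "diag d = (\<chi> i j. if i = j then d $ i else 0)"

text \<open>Stated for any set \<open>I\<close> of indices so that induction can add one eigenvector
  at a time; \<open>I = UNIV\<close> gives an orthonormal eigenbasis.\<close>

lemma orthonormal_eigenvectors:
  fixes E :: "complex^'n^'n" and I :: "'n set"
  assumes "hermitian E"
  shows "\<exists>f. (\<forall>i\<in>I. norm (f i) = 1 \<and> (\<exists>l. E *v f i = l *s f i)) \<and>
    (\<forall>i\<in>I. \<forall>j\<in>I. i \<noteq> j \<longrightarrow> cinner (f i) (f j) = 0)"
  using finite [of I]
proof (induction I rule: finite_induct)
  case (insert k I)
  from insert.IH obtain f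
    where "(\<forall>i\<in>I. norm (f i) = 1 \<and> (\<exists>l. E *v f i = l *s f i)) \<and>
      (\<forall>i\<in>I. \<forall>j\<in>I. i \<noteq> j \<longrightarrow> cinner (f i) (f j) = 0)"
    by (rule exE)
  then have f: "\<forall>i\<in>I. norm (f i) = 1 \<and> (\<exists>l. E *v f i = l *s f i)"
    "\<forall>i\<in>I. \<forall>j\<in>I. i \<noteq> j \<longrightarrow> cinner (f i) (f j) = 0"
    by (rule conjunct1, rule conjunct2)
  have "I \<noteq> UNIV"
    using insert.hyps(2) by blast
  then obtain v l where v: "norm v = 1" "\<And>i. i \<in> I \<Longrightarrow> cinner v (f i) = 0" "E *v v = l *s v"
    using exists_orthogonal_eigenvector [OF assms, of I f] f(1) by blast
  have v': "cinner (f i) v = 0" if "i \<in> I" for i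
    using v(2) [OF that] by (subst cinner_commute) simp
  show ?case
  proof (rule exI [of _ "f(k := v)"], intro conjI ballI impI)
    fix i assume i: "i \<in> insert k I"
    show "norm ((f(k := v)) i) = 1"
      using i f(1) v(1) by (cases "i = k") simp_all
    show "\<exists>l. E *v (f(k := v)) i = l *s (f(k := v)) i"
    proof (cases "i = k")
      case False
      then have "i \<in> I"
        using i by simp
      then show ?thesis
        using f(1) False by (metis fun_upd_other)
    qed (use v(3) in auto)
    fix j assume "j \<in> insert k I" "i \<noteq> j"
    then show "cinner ((f(k := v)) i) ((f(k := v)) j) = 0"
      using i f(2) v(2) v' by (cases "i = k"; cases "j = k") simp_all
  qed
qed simp

lemma hermitian_diagonalisable:
  fixes E :: "complex^'n^'n"
  assumes "hermitian E"
  obtains V d where "V \<in> unitary_mats" "E ** V = V ** diag d"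
proof -
  obtain f :: "'n \<Rightarrow> complex^'n" where f: "\<And>i. norm (f i) = 1" "\<And>i. \<exists>l. E *v f i = l *s f i"
    "\<And>i j. i \<noteq> j \<Longrightarrow> cinner (f i) (f j) = 0"
    using orthonormal_eigenvectors [OF assms, of UNIV] by auto
  obtain l where l: "\<And>i. E *v f i = l i *s f i"
    using f(2) by metis
  \<comment> \<open>The eigenvectors become the columns of \<open>V\<close>, so
    \<open>cadjoint V ** V\<close> is their Gram matrix.\<close>
  define V where "V = (\<chi> i j. f j $ i)"
  have "(cadjoint V ** V) $ i $ j = cinner (f j) (f i)" for i j
    by (simp add: V_def cadjoint_def matrix_matrix_mult_def cinner_def mult.commute)
  then have "cadjoint V ** V = mat 1"
    using f by (auto simp: vec_eq_iff mat_def cinner_self)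
  moreover have "(E ** V) $ i $ j = (V ** diag (\<chi> i. l i)) $ i $ j" for i j
    using arg_cong [OF l [of j], of "\<lambda>x. x $ i"]
    by (simp add: V_def diag_def matrix_matrix_mult_def matrix_vector_mult_def mult.commute
        if_distrib [of "\<lambda>x. x * _"] if_distrib [of "\<lambda>x. _ * x"] cong: if_cong)
  ultimately show ?thesis
    by (intro that [of V]) (auto simp: unitary_iff' vec_eq_iff)
qed

section \<open>Diagonal maximal tori\<close>

lemma diag_mult_left: "(diag d ** A) $ i $ j = d $ i * (A $ i $ j :: 'a::semiring_1)"
  by (simp add: diag_def matrix_matrix_mult_def if_distrib [of "\<lambda>x. x * _"] cong: if_cong)

lemma diag_mult_right: "(A ** diag d) $ i $ j = (A $ i $ j :: 'a::semiring_1) * d $ j"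
  by (simp add: diag_def matrix_matrix_mult_def if_distrib [of "\<lambda>x. _ * x"] cong: if_cong)

lemma diag_mult_diag: "diag c ** diag d = diag (\<chi> i. c $ i * (d $ i :: 'a::semiring_1))"
  by (simp add: vec_eq_iff diag_mult_left) (simp add: diag_def)

lemma cadjoint_diag: "cadjoint (diag d) = diag (\<chi> i. cnj (d $ i))"
  by (simp add: cadjoint_def diag_def vec_eq_iff)

lemma diag_1: "diag (\<chi> i. 1) = mat 1"
  by (simp add: diag_def mat_def vec_eq_iff)

lemma det_diag: "det (diag d) = (\<Prod>i\<in>UNIV. d $ i :: 'a::comm_ring_1)"
  by (subst det_diagonal) (simp_all add: diag_def)

lemma det_conj_unitary:
  assumes "V \<in> unitary_mats"
  shows "det (V ** A ** cadjoint V) = det A"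
proof -
  have "det V * det (cadjoint V) = 1"
    by (metis assms det_I det_mul unitaryD(1))
  then show ?thesis
    by (simp add: det_mul mult_ac)
qed

text \<open>The diagonals of the diagonal matrices in SU(N). Keeping them as vectors allows
  compactness and connectedness to be proved here and transported by a continuous map.\<close>

definition torus_entries :: "(complex^'n) set" where
  "torus_entries = {d. (\<forall>i. cmod (d $ i) = 1) \<and> (\<Prod>i\<in>UNIV. d $ i) = 1}"

lemma diag_unitary_iff: "diag d \<in> unitary_mats \<longleftrightarrow> (\<forall>i. cmod (d $ i) = 1)"
proof
  assume *: "diag d \<in> unitary_mats"
  have "(diag d ** cadjoint (diag d)) $ i $ i = of_real ((cmod (d $ i))\<^sup>2)" for i
    unfolding complex_norm_square by (simp add: diag_mult_left cadjoint_diag) (simp add: diag_def)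
  then have "complex_of_real ((cmod (d $ i))\<^sup>2) = mat 1 $ i $ i" for i
    by (simp only: unitaryD(1) [OF *])
  then have "(cmod (d $ i))\<^sup>2 = 1" for i
    by (simp only: mat_def vec_lambda_beta if_True of_real_eq_1_iff simp_thms)
  then show "\<forall>i. cmod (d $ i) = 1"
    by (smt (verit) norm_ge_zero power2_eq_1_iff)
next
  assume "\<forall>i. cmod (d $ i) = 1"
  then show "diag d \<in> unitary_mats"
    by (simp add: unitary_iff cadjoint_diag diag_mult_diag unit_mult_cnj diag_1)
qed

lemma compact_torus_entries: "compact (torus_entries :: (complex^'n) set)"
  unfolding compact_eq_bounded_closed
proof
  have "norm d \<le> (\<Sum>i\<in>(UNIV::'n set). 1)" if "d \<in> torus_entries" for d :: "complex^'n"
  proof -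
    have "norm d \<le> (\<Sum>i\<in>UNIV. cmod (d $ i))"
      by (simp add: norm_vec_def L2_set_le_sum)
    then show ?thesis
      using that by (simp add: torus_entries_def)
  qed
  then show "bounded (torus_entries :: (complex^'n) set)"
    unfolding bounded_iff by blast
  show "closed (torus_entries :: (complex^'n) set)"
    unfolding torus_entries_def
    by (intro closed_Collect_conj closed_Collect_all closed_Collect_eq continuous_intros)
qed

text \<open>The set is the image of the hyperplane of angles with sum 0, which is convex, under the
  coordinatewise map \<open>cis\<close>.\<close>

lemma connected_torus_entries: "connected (torus_entries :: (complex^'n) set)"
proof -
  define H where "H = {t :: real^'n. (\<Sum>i\<in>UNIV. t $ i) = 0}"
  have "torus_entries = (\<lambda>t. \<chi> i. cis (t $ i)) ` H"
  proof (intro equalityI subsetI)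
    fix d :: "complex^'n" assume d: "d \<in> torus_entries"
    define t where "t i = Arg (d $ i)" for i
    have t: "d $ i = cis (t i)" for i
      using rcis_cmod_Arg [of "d $ i"] d by (simp add: t_def torus_entries_def rcis_def)
    have "cis (\<Sum>i\<in>UNIV. t i) = 1"
      using d by (simp add: torus_entries_def t cis_conv_exp sum_distrib_left flip: exp_sum)
    then obtain m :: int where m: "(\<Sum>i\<in>UNIV. t i) = of_int m * (2 * pi)"
      by (auto simp: complex_eq_iff cos_one_2pi_int mult_ac)
    obtain k :: 'n where True
      by simp
    \<comment> \<open>The principal arguments sum to a multiple of \<open>2 * pi\<close>.
      Subtracting it from one coordinate makes the sum 0 and leaves every value of
      \<open>cis\<close> unchanged.\<close>
    define s where "s = (\<chi> i. t i - (if i = k then of_int m * (2 * pi) else 0))"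
    have "s \<in> H"
      by (simp add: H_def s_def sum_subtractf m)
    moreover have "cis (s $ i) = d $ i" for i
      using cis_multiple_2pi [of "of_int m"]
      by (simp add: s_def t mult_ac flip: cis_divide)
    ultimately show "d \<in> (\<lambda>t. \<chi> i. cis (t $ i)) ` H"
      by (intro image_eqI [of _ _ s]) (simp_all add: vec_eq_iff)
  next
    fix d assume "d \<in> (\<lambda>t. \<chi> i. cis (t $ i)) ` H"
    then obtain t where t: "(\<Sum>i\<in>UNIV. t $ i) = 0" "d = (\<chi> i. cis (t $ i))"
      by (auto simp: H_def)
    have "(\<Prod>i\<in>UNIV. cis (t $ i)) = exp (\<i> * of_real (\<Sum>i\<in>UNIV. t $ i))"
      by (simp add: cis_conv_exp sum_distrib_left exp_sum)
    then show "d \<in> torus_entries"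
      using t by (simp add: torus_entries_def)
  qed
  moreover have "connected ((\<lambda>t. \<chi> i. cis (t $ i)) ` H)"
  proof (intro connected_continuous_image convex_connected)
    show "convex H"
      by (simp add: H_def convex_def sum.distrib flip: sum_distrib_left)
    show "continuous_on H (\<lambda>t. \<chi> i. cis (t $ i))"
      by (intro continuous_intros)
  qed
  ultimately show ?thesis
    by simp
qed

text \<open>The standard diagonal torus of SU(N), conjugated by \<open>V\<close>; for unitary
  \<open>V\<close> its elements are diagonal in the basis of columns of \<open>V\<close>.\<close>

definition diag_torus :: "complex^'n^'n \<Rightarrow> (complex^'n^'n) set" where
  "diag_torus V = (\<lambda>d. V ** diag d ** cadjoint V) ` torus_entries"

section \<open>The special unitary group and its diagonal tori\<close>

lemma det_cadjoint_eq_1: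
  assumes "U \<in> unitary_mats" "det U = 1"
  shows "det (cadjoint U) = 1"
  using assms by (metis det_I det_mul mult_1 unitaryD(1))

lemma group_special_unitary_group: "group special_unitary_group"
proof (rule groupI)
  fix U assume "U \<in> carrier special_unitary_group"
  then have U: "U \<in> unitary_mats" "det U = 1"
    by (auto simp: special_unitary_group_def)
  then have "cadjoint U \<in> carrier special_unitary_group"
    using U by (simp add: special_unitary_group_def unitary_cadjoint det_cadjoint_eq_1)
  moreover have "cadjoint U \<otimes>\<^bsub>special_unitary_group\<^esub> U = \<one>\<^bsub>special_unitary_group\<^esub>"
    using U by (simp add: special_unitary_group_def unitaryD)
  ultimately show "\<exists>V\<in>carrier special_unitary_group.
      V \<otimes>\<^bsub>special_unitary_group\<^esub> U = \<one>\<^bsub>special_unitary_group\<^esub>"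
    by (rule bexI [rotated])
qed (auto simp: special_unitary_group_def unitary_mult matrix_mul_assoc det_mul)

lemma inv_special_unitary_group:
  assumes "U \<in> carrier special_unitary_group"
  shows "inv\<^bsub>special_unitary_group\<^esub> U = cadjoint U"
proof (rule group.inv_equality [OF group_special_unitary_group])
  have U: "U \<in> unitary_mats" "det U = 1"
    using assms by (auto simp: special_unitary_group_def)
  show "cadjoint U \<in> carrier special_unitary_group"
    using U by (simp add: special_unitary_group_def unitary_cadjoint det_cadjoint_eq_1)
  show "cadjoint U \<otimes>\<^bsub>special_unitary_group\<^esub> U = \<one>\<^bsub>special_unitary_group\<^esub>"
    using U by (simp add: special_unitary_group_def unitaryD)
qed (rule assms)

lemma diag_torus_subset:
  assumes V: "V \<in> unitary_mats"
  shows "diag_torus V \<subseteq> carrier special_unitary_group"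
proof
  fix U assume "U \<in> diag_torus V"
  then obtain d where d: "d \<in> torus_entries" "U = V ** diag d ** cadjoint V"
    by (auto simp: diag_torus_def)
  then have "diag d \<in> unitary_mats" "det (diag d) = 1"
    by (auto simp: torus_entries_def diag_unitary_iff det_diag)
  then show "U \<in> carrier special_unitary_group"
    using V by (simp add: d(2) special_unitary_group_def unitary_mult unitary_cadjoint det_conj_unitary)
qed

text \<open>The inner factors \<open>cadjoint V ** V\<close> cancel. As \<open>c\<close> and
  \<open>d\<close> are arbitrary, this also covers products with \<open>E\<close> written in its
  eigenbasis.\<close>

lemma diag_torus_mult:
  assumes V: "V \<in> unitary_mats"
  shows "(V ** diag c ** cadjoint V) ** (V ** diag d ** cadjoint V) =
    V ** diag (\<chi> i. c $ i * d $ i) ** cadjoint V"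
  using V by (simp add: unitaryD flip: matrix_mul_assoc diag_mult_diag)

text \<open>Compactness and connectedness come from \<open>torus_entries\<close> by continuity, and
  commutativity from that of entrywise multiplication.\<close>

lemma torus_in_diag_torus:
  fixes V :: "complex^'n^'n"
  assumes V: "V \<in> unitary_mats"
  shows "torus_in (diag_torus V) special_unitary_group"
proof -
  let ?G = "special_unitary_group :: (complex^'n^'n) monoid"
  have cont: "continuous_on torus_entries (\<lambda>d. V ** diag d ** cadjoint V)"
  proof -
    have "continuous_on torus_entries (\<lambda>d. if i = j then d $ i else 0)" for i j :: 'n
      by (cases "i = j") (auto intro: continuous_intros)
    then show ?thesis
      unfolding diag_def by (intro continuous_intros) auto
  qed
  have sub: "subgroup (diag_torus V) ?G"
  proof (rule group.subgroupI [OF group_special_unitary_group diag_torus_subset [OF V]])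
    have "(\<chi> i. 1) \<in> (torus_entries :: (complex^'n) set)"
      by (simp add: torus_entries_def)
    then show "diag_torus V \<noteq> {}"
      by (auto simp: diag_torus_def)
  next
    fix U assume U: "U \<in> diag_torus V"
    then obtain d where d: "d \<in> torus_entries" "U = V ** diag d ** cadjoint V"
      by (auto simp: diag_torus_def)
    have "(\<Prod>i\<in>UNIV. cnj (d $ i)) = 1"
      using d(1) by (simp add: torus_entries_def flip: cnj_prod)
    then have "(\<chi> i. cnj (d $ i)) \<in> torus_entries"
      using d(1) by (simp add: torus_entries_def)
    moreover have "cadjoint U = V ** diag (\<chi> i. cnj (d $ i)) ** cadjoint V"
      by (simp add: d(2) cadjoint_mult cadjoint_diag matrix_mul_assoc)
    moreover have "inv\<^bsub>?G\<^esub> U = cadjoint U"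
      using U diag_torus_subset [OF V] by (intro inv_special_unitary_group) auto
    ultimately show "inv\<^bsub>?G\<^esub> U \<in> diag_torus V"
      by (simp add: diag_torus_def)
  next
    fix U W assume "U \<in> diag_torus V" "W \<in> diag_torus V"
    then obtain c d where *: "c \<in> torus_entries" "U = V ** diag c ** cadjoint V"
      "d \<in> torus_entries" "W = V ** diag d ** cadjoint V"
      by (auto simp: diag_torus_def)
    have "(\<chi> i. c $ i * d $ i) \<in> torus_entries"
      using *(1,3) by (simp add: torus_entries_def norm_mult prod.distrib)
    then show "U \<otimes>\<^bsub>?G\<^esub> W \<in> diag_torus V"
      by (auto simp: special_unitary_group_def *(2,4) diag_torus_mult [OF V] diag_torus_def)
  qed
  have "comm_group (?G\<lparr>carrier := diag_torus V\<rparr>)"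
  proof (rule group.group_comm_groupI)
    show "group (?G\<lparr>carrier := diag_torus V\<rparr>)"
      by (rule subgroup.subgroup_is_group [OF sub group_special_unitary_group])
    fix U W assume "U \<in> carrier (?G\<lparr>carrier := diag_torus V\<rparr>)" "W \<in> carrier (?G\<lparr>carrier := diag_torus V\<rparr>)"
    then show "U \<otimes>\<^bsub>?G\<lparr>carrier := diag_torus V\<rparr>\<^esub> W = W \<otimes>\<^bsub>?G\<lparr>carrier := diag_torus V\<rparr>\<^esub> U"
      by (auto simp: special_unitary_group_def diag_torus_def diag_torus_mult [OF V] mult.commute)
  qed
  moreover have "compact (diag_torus V)" "connected (diag_torus V)"
    unfolding diag_torus_def
    by (intro compact_continuous_image connected_continuous_image cont
        compact_torus_entries connected_torus_entries)+
  ultimately show ?thesis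
    using sub by (simp add: torus_in_def compact_connected_subgroup_def)
qed

text \<open>A matrix commuting with \<open>diag(1,\<dots>,\<i>,\<dots>,-\<i>,\<dots>,1)\<close> has no entries linking the two
  special positions.\<close>

lemma commutes_torus_imp_diag:
  fixes A :: "complex^'n^'n"
  assumes comm: "\<And>d. d \<in> torus_entries \<Longrightarrow> A ** diag d = diag d ** A"
  shows "A = diag (\<chi> i. A $ i $ i)"
proof -
  have "A $ i $ j = 0" if "i \<noteq> j" for i j
  proof -
    define d :: "complex^'n" where "d = (\<chi> k. if k = i then \<i> else if k = j then - \<i> else 1)"
    have "(\<Prod>k\<in>UNIV. d $ k) = (\<Prod>k\<in>{i, j}. d $ k)"
      by (rule prod.mono_neutral_right) (auto simp: d_def)
    also have "\<dots> = 1"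
      using that by (simp add: d_def)
    finally have "d \<in> torus_entries"
      by (simp add: torus_entries_def d_def)
    \<comment> \<open>These entries are \<open>- \<i>\<close> and \<open>\<i>\<close> times
      \<open>A $ i $ j\<close>, so equality forces \<open>A $ i $ j = 0\<close>.\<close>
    then have "(A ** diag d) $ i $ j = (diag d ** A) $ i $ j"
      by (simp add: comm)
    then show ?thesis
      using that by (simp add: diag_mult_left diag_mult_right d_def)
  qed
  then show ?thesis
    by (simp add: vec_eq_iff diag_def)
qed

text \<open>A torus containing \<open>diag_torus V\<close> is abelian, so each of its elements
  commutes with \<open>diag_torus V\<close> and is diagonal in the basis given by \<open>V\<close>;
  being in SU(N), it already belongs to \<open>diag_torus V\<close>.\<close>

lemma maximal_torus_diag_torus:
  fixes V :: "complex^'n^'n"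
  assumes V: "V \<in> unitary_mats"
  shows "maximal_torus_in (diag_torus V) special_unitary_group"
  unfolding maximal_torus_in_def
proof (intro conjI allI impI)
  fix T assume "torus_in T special_unitary_group \<and> diag_torus V \<subseteq> T"
  then have T: "subgroup T special_unitary_group" "diag_torus V \<subseteq> T"
    "comm_group (special_unitary_group\<lparr>carrier := T\<rparr>)"
    by (auto simp: torus_in_def compact_connected_subgroup_def)
  have comm: "U ** W = W ** U" if "U \<in> T" "W \<in> T" for U W
    using comm_monoid.m_comm [OF comm_group.axioms(1) [OF T(3)], of U W] that
    by (simp add: special_unitary_group_def)
  have "U \<in> diag_torus V" if U: "U \<in> T" for U
  proof -
    \<comment> \<open>The matrix of \<open>U\<close> in the basis of columns of
      \<open>V\<close>.\<close>
    define A where "A = cadjoint V ** U ** V"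
    have U_eq: "U = V ** A ** cadjoint V"
      using V by (simp add: A_def unitaryD flip: matrix_mul_assoc)
    have SU: "U \<in> unitary_mats" "det U = 1"
      using U subgroup.subset [OF T(1)] by (auto simp: special_unitary_group_def)
    have "A ** diag d = diag d ** A" if "d \<in> torus_entries" for d
    proof -
      have "V ** diag d ** cadjoint V \<in> T"
        using T(2) that by (auto simp: diag_torus_def)
      from comm [OF U this]
      have "cadjoint V ** (U ** (V ** diag d ** cadjoint V)) ** V =
          cadjoint V ** (V ** diag d ** cadjoint V ** U) ** V"
        by simp
      then show ?thesis
        using V by (simp add: A_def unitaryD flip: matrix_mul_assoc)
    qed
    then have A: "A = diag (\<chi> i. A $ i $ i)"
      by (rule commutes_torus_imp_diag)
    have "A \<in> unitary_mats"
      using V SU by (simp add: A_def unitary_mult unitary_cadjoint)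
    moreover have "det A = 1"
      using SU(2) V by (simp add: U_eq det_conj_unitary)
    ultimately have "diag (\<chi> i. A $ i $ i) \<in> unitary_mats" "det (diag (\<chi> i. A $ i $ i)) = 1"
      by (simp_all only: flip: A)
    then have "(\<chi> i. A $ i $ i) \<in> torus_entries"
      by (simp add: torus_entries_def diag_unitary_iff det_diag)
    moreover have "U = V ** diag (\<chi> i. A $ i $ i) ** cadjoint V"
      by (simp only: U_eq flip: A)
    ultimately show ?thesis
      unfolding diag_torus_def by (rule image_eqI [rotated])
  qed
  then show "T = diag_torus V"
    using T(2) by blast
qed (rule torus_in_diag_torus [OF V])

text \<open>Take the diagonal torus of an orthonormal eigenbasis of \<open>E\<close>: matrices
  diagonal in the same basis commute.\<close>

lemma hermitian_stabiliser_contains_maximal_torus: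
  fixes E :: "complex^'n^'n"
  assumes "hermitian E"
  shows "\<exists>T. maximal_torus_in T special_unitary_group \<and> T \<subseteq> stabiliser E"
proof -
  obtain V l where V: "V \<in> unitary_mats" and EV: "E ** V = V ** diag l"
    using hermitian_diagonalisable [OF assms] .
  have E: "E = V ** diag l ** cadjoint V"
    using V by (simp add: unitaryD flip: matrix_mul_assoc EV)
  have "U \<in> stabiliser E" if U: "U \<in> diag_torus V" for U
  proof -
    have "U \<in> unitary_mats"
      using U diag_torus_subset [OF V] by (auto simp: special_unitary_group_def)
    moreover have "U ** E = E ** U"
      using U by (auto simp: E diag_torus_def diag_torus_mult [OF V] mult.commute)
    ultimately show ?thesis
      by (simp add: stabiliser_iff)
  qed
  then show ?thesis
    using maximal_torus_diag_torus [OF V] by blast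
qed

section \<open>Relative numerical range and radius\<close>

text \<open>Cyclicity of the trace reconciles the order of factors in the relative range with that
  in the constrained range.\<close>

lemma trace_rotate: "trace (cadjoint C ** U ** A ** cadjoint U) =
    trace (U ** A ** cadjoint U ** cadjoint (C :: complex^'n^'n))"
  using trace_mul_sym [of "cadjoint C" "U ** A ** cadjoint U"]
  by (simp add: matrix_mul_assoc)

lemma constrained_eq_relative_numerical_range:
  "constrained_numerical_range (\<lambda>U. Ad U E = E) C A
    = relative_numerical_range (stabiliser E) C A"
  by (auto simp: constrained_numerical_range_def relative_numerical_range_def stabiliser_def
      trace_rotate)

lemma continuous_on_trace_orbit:
  "continuous_on S (\<lambda>K. trace (cadjoint C ** K ** A ** cadjoint (K :: complex^'n^'n)))"
  by (intro continuous_intros)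

lemma connected_relative_numerical_range:
  assumes "connected K"
  shows "connected (relative_numerical_range K C A)"
  unfolding relative_numerical_range_def Setcompr_eq_image
  by (intro connected_continuous_image continuous_on_trace_orbit assms)

text \<open>By the extreme value theorem a maximiser exists, so the \<open>GREATEST\<close> in the
  definition of the radius denotes an attained maximum.\<close>

lemma relative_numerical_radius_attained:
  assumes "compact S" "S \<noteq> {}"
  obtains K where "K \<in> S"
    "cmod (trace (cadjoint C ** K ** A ** cadjoint K)) = relative_numerical_radius S C A"
    "\<And>U. U \<in> S \<Longrightarrow>
      cmod (trace (cadjoint C ** U ** A ** cadjoint U)) \<le> relative_numerical_radius S C A"
proof -
  let ?f = "\<lambda>K. cmod (trace (cadjoint C ** K ** A ** cadjoint K))"
  have "continuous_on S ?f"
    by (intro continuous_on_norm continuous_on_trace_orbit)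
  then obtain K where K: "K \<in> S" "\<And>U. U \<in> S \<Longrightarrow> ?f U \<le> ?f K"
    using continuous_attains_sup [OF assms] by blast
  then have "relative_numerical_radius S C A = ?f K"
    unfolding relative_numerical_radius_def by (intro Greatest_equality) auto
  then show ?thesis
    using that K by metis
qed

theorem corollary3p4:
  fixes A C E :: "complex^'n^'n"
  shows "(nontrivially_solvable E \<longrightarrow>
            connected (constrained_numerical_range (\<lambda>U. Ad U E = E) C A)
          \<and> compact_connected_subgroup (stabiliser E) unitary_group
          \<and> constrained_numerical_range (\<lambda>U. Ad U E = E) C A
              = relative_numerical_range (stabiliser E) C A
          \<and> (\<exists>U\<in>unitary_mats. Ad U E = E \<and>
               cmod (trace (U ** A ** cadjoint U ** cadjoint C))
                 = relative_numerical_radius (stabiliser E) C A)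
          \<and> (\<forall>U\<in>unitary_mats. Ad U E = E \<longrightarrow>
               cmod (trace (U ** A ** cadjoint U ** cadjoint C))
                 \<le> relative_numerical_radius (stabiliser E) C A))
       \<and> (hermitian E \<longrightarrow>
            (\<exists>T. maximal_torus_in T special_unitary_group \<and> T \<subseteq> stabiliser E))"
proof -
  \<comment> \<open>The identity matrix is feasible, so the maximum is taken over a nonempty compact
    set.\<close>
  have "stabiliser E \<noteq> {}"
    using mat_in_stabiliser [of 1] by auto
  then obtain K where K: "K \<in> stabiliser E"
    "cmod (trace (cadjoint C ** K ** A ** cadjoint K)) = relative_numerical_radius (stabiliser E) C A"
    "\<And>U. U \<in> stabiliser E \<Longrightarrow> cmod (trace (cadjoint C ** U ** A ** cadjoint U))
      \<le> relative_numerical_radius (stabiliser E) C A"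
    using relative_numerical_radius_attained [OF compact_stabiliser] by blast
  have "\<exists>U\<in>unitary_mats. Ad U E = E \<and> cmod (trace (U ** A ** cadjoint U ** cadjoint C))
      = relative_numerical_radius (stabiliser E) C A"
    using K(1,2) unfolding stabiliser_def trace_rotate by blast
  moreover have "\<forall>U\<in>unitary_mats. Ad U E = E \<longrightarrow>
      cmod (trace (U ** A ** cadjoint U ** cadjoint C)) \<le> relative_numerical_radius (stabiliser E) C A"
    using K(3) unfolding trace_rotate by (simp add: stabiliser_def)
  moreover have "compact_connected_subgroup (stabiliser E) unitary_group"
    by (simp add: compact_connected_subgroup_def compact_stabiliser subgroup_stabiliser
        connected_stabiliser)
  ultimately show ?thesis
    using connected_relative_numerical_range [OF connected_stabiliser, of E C A]
      hermitian_stabiliser_contains_maximal_torus [of E]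
    unfolding constrained_eq_relative_numerical_range by iprover
qed

end
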